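(* Consider the Newtonian $N$-body problem in a Euclidean space $E$ with masses $m_1,\dots,m_N>0$. There are positive constants $\alpha$ and $\beta$ such that, for any two configurations $x,y\in E^N$ and any $h\ge 0$, $$\phi_h(x,y)\le\left(\alpha\|x-y\|+h\,\beta\,\|x-y\|^2\right)^{1/2}.$$
   Context: $E$ is a finite-dimensional Euclidean space, $N\ge 2$, $m_1,\dots,m_N>0$. For $x=(r_1,\dots,r_N),\,y=(s_1,\dots,s_N)\in E^N$ the mass inner product is $\langle x,y\rangle=\sum_i m_i\langle r_i,s_i\rangle_E$, with norm $\|\cdot\|$. The Newtonian potential is $U(x)=\sum_{i<j}m_im_j\|r_i-r_j\|_E^{-1}\in(0,+\infty]$. For $h\ge0$ the action potential is $$\phi_h(x,y)=\inf_\gamma \int_a^b\Big(\tfrac12\|\dot\gamma\|^2+U(\gamma)+h\Big)\,dt,$$ the infimum being over all absolutely continuous curves $\gamma:[a,b]\to E^N$ (with $a<b$ arbitrary), $\gamma(a)=x$, $\gamma(b)=y$. *)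

theory Defs
  imports "HOL-Analysis.Analysis"
begin

text \<open>
  The configuration space \<open>E\<^sup>N\<close> is \<open>'e ^ 'n\<close>, where \<open>'e\<close> is a Euclidean space and the finite
  linearly ordered type \<open>'n\<close> plays the role of the index set \<open>{1, \<dots>, N}\<close>.  The library norm on
  \<open>'e ^ 'n\<close> (type \<open>('e, 'n) vec\<close>) ignores the masses; the norm of the mass inner product is \<open>mass_norm\<close>.
\<close>

definition mass_inner :: "('n::finite \<Rightarrow> real) \<Rightarrow> 'e::euclidean_space ^ 'n \<Rightarrow> 'e ^ 'n \<Rightarrow> real" where
  "mass_inner m x y = (\<Sum>i\<in>UNIV. m i * (x $ i \<bullet> y $ i))"

definition mass_norm :: "('n::finite \<Rightarrow> real) \<Rightarrow> 'e::euclidean_space ^ 'n \<Rightarrow> real" where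
  "mass_norm m x = sqrt (mass_inner m x x)"

text \<open>
  Division is taken in \<^typ>\<open>ennreal\<close>, where a positive number divided by \<open>0\<close> is \<open>\<infinity>\<close>: the potential
  is infinite exactly at the configurations with a collision.
\<close>

definition newton_potential ::
  "('n::{finite,linorder} \<Rightarrow> real) \<Rightarrow> ('e::euclidean_space, 'n) vec \<Rightarrow> ennreal" where
  "newton_potential m x =
     (\<Sum>(i, j)\<in>{(i, j). i < j}. ennreal (m i * m j) / ennreal (norm (x $ i - x $ j)))"

text \<open>
  For maps into a finite-dimensional space the following notion is the same for all norms, in
  particular for the library norm on \<open>'e ^ 'n\<close> and for \<open>mass_norm\<close> with positive masses.
\<close>

definition abs_continuous_on :: "real \<Rightarrow> real \<Rightarrow> (real \<Rightarrow> 'a::real_normed_vector) \<Rightarrow> bool" where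
  "abs_continuous_on a b f \<longleftrightarrow>
     (\<forall>\<epsilon>>0. \<exists>\<delta>>0. \<forall>D :: (real \<times> real) set.
        finite D \<longrightarrow>
        (\<forall>(u, v)\<in>D. a \<le> u \<and> u < v \<and> v \<le> b) \<longrightarrow>
        disjoint_family_on (\<lambda>(u, v). {u<..<v}) D \<longrightarrow>
        (\<Sum>(u, v)\<in>D. v - u) < \<delta> \<longrightarrow>
        (\<Sum>(u, v)\<in>D. norm (f v - f u)) < \<epsilon>)"

text \<open>
  An absolutely continuous curve is differentiable almost everywhere, so the arbitrary value of
  \<^const>\<open>vector_derivative\<close> at other times affects neither the integral nor the Lebesgue
  measurability of the integrand.  The integral may be infinite.
\<close>

definition lagrangian_action ::
  "('n::{finite,linorder} \<Rightarrow> real) \<Rightarrow> real \<Rightarrow> real \<Rightarrow> real \<Rightarrow> (real \<Rightarrow> ('e::euclidean_space, 'n) vec)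
    \<Rightarrow> ennreal" where
  "lagrangian_action m h a b \<gamma> =
     (\<integral>\<^sup>+t\<in>{a..b}. (ennreal (1/2 * (mass_norm m (vector_derivative \<gamma> (at t within {a..b})))\<^sup>2)
                  + newton_potential m (\<gamma> t) + ennreal h) \<partial>lebesgue)"

definition action_potential ::
  "('n::{finite,linorder} \<Rightarrow> real) \<Rightarrow> real \<Rightarrow> ('e::euclidean_space, 'n) vec \<Rightarrow> ('e, 'n) vec \<Rightarrow> ennreal" where
  "action_potential m h x y =
     Inf {lagrangian_action m h a b \<gamma> | a b \<gamma>.
            a < b \<and> abs_continuous_on a b \<gamma> \<and> \<gamma> a = x \<and> \<gamma> b = y}"

end

theory Submission
  imports Defs
begin

text \<open>
  Since the duration of the curves is free, the action potential is governed by the Jacobi length,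
  the integral of \<open>sqrt (2 * (U + h))\<close> with respect to arc length: any path, run at the right speed,
  has an action comparable to its Jacobi length (\<open>action_potential_le_jacobi_length\<close>).  The potential has
  poles of order one at collisions, and these are not integrable, but its square root is integrable
  along a straight line on which two bodies collide with nonzero relative velocity.  So collisions,
  unavoidable when bodies on a line have to change their order, keep the Jacobi length finite.

  It remains to choose a path on which all relative velocities are bounded below.  Let \<open>R\<close> be the
  distance from \<open>x\<close> to \<open>y\<close>.  Going straight from \<open>x\<close> to \<open>x + p\<close> and then straight to \<open>y\<close>, where \<open>p\<close> is a
  large multiple of \<open>R\<close> times a fixed configuration without collisions, every relative velocity has
  size at least \<open>R\<close> and the path has length of order \<open>R\<close>.  Each mutual distance is then at least \<open>R\<close>
  times the time to the nearest of finitely many instants (\<open>two_leg_path_separation\<close>), so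
  \<open>sqrt (U + h)\<close> is at most \<open>sqrt h\<close> plus a constant times \<open>1 / sqrt (R * d)\<close>, where \<open>d\<close> is this time.
  Multiplying by the speed and integrating gives a bound of order \<open>R * sqrt h + sqrt R\<close>, whose square is
  of order \<open>R + h * R\<^sup>2\<close>.

  The analytic work lies in the change of speed, which becomes infinite at collisions.  The
  reparametrized curve is absolutely continuous because it has finite energy
  (\<open>abs_continuous_on_energy\<close>).  The case \<open>x = y\<close> follows by letting \<open>R\<close> decrease to 0.
\<close>

section \<open>Absolute continuity from an energy estimate\<close>

text \<open>
  A monotone function carries disjoint intervals to disjoint intervals, so finitely many of its
  increments add up to at most the length of the interval that contains all the images.
\<close>

lemma sum_increments_le:
  fixes W :: "real \<Rightarrow> real" and D :: "(real \<times> real) set"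
  assumes mono: "mono_on {a..b} W" and "a \<le> b" and fin: "finite D"
    and sub: "\<And>u v. (u, v) \<in> D \<Longrightarrow> a \<le> u \<and> u < v \<and> v \<le> b"
    and disj: "disjoint_family_on (\<lambda>(u, v). {u<..<v}) D"
  shows "(\<Sum>(u, v)\<in>D. W v - W u) \<le> W b - W a"
proof -
  have W: "W u \<le> W v" if "a \<le> u" "u \<le> v" "v \<le> b" for u v
    using that by (intro mono_onD[OF mono]) auto
  have disjW: "disjoint_family_on (\<lambda>(u, v). {W u<..<W v}) D"
    unfolding disjoint_family_on_def
  proof (intro ballI impI)
    fix p q assume pq: "p \<in> D" "q \<in> D" "p \<noteq> q"
    obtain u v u' v' where uv: "p = (u, v)" "q = (u', v')" by (cases p, cases q) auto
    with pq have D: "(u, v) \<in> D" "(u', v') \<in> D" and ne: "(u, v) \<noteq> (u', v')" by auto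
    have "{u<..<v} \<inter> {u'<..<v'} = {}"
      using disj D ne unfolding disjoint_family_on_def by fastforce
    then have "v \<le> u' \<or> v' \<le> u"
    proof (rule contrapos_pp)
      assume "\<not> (v \<le> u' \<or> v' \<le> u)"
      then have "(max u u' + min v v') / 2 \<in> {u<..<v} \<inter> {u'<..<v'}"
        using sub[OF D(1)] sub[OF D(2)] by (auto simp: max_def min_def)
      then show "{u<..<v} \<inter> {u'<..<v'} \<noteq> {}" by blast
    qed
    then have "W v \<le> W u' \<or> W v' \<le> W u"
      using sub[OF D(1)] sub[OF D(2)] W by auto
    then show "(\<lambda>(u, v). {W u<..<W v}) p \<inter> (\<lambda>(u, v). {W u<..<W v}) q = {}"
      by (auto simp: uv)
  qed
  \<comment> \<open>The increments are the lengths of disjoint subintervals of the interval from W a to W b.\<close>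
  have "ennreal (\<Sum>(u, v)\<in>D. W v - W u) = (\<Sum>(u, v)\<in>D. ennreal (W v - W u))"
    using sub W by (subst sum_ennreal[symmetric]) (force simp: split_def intro!: sum.cong)+
  also have "\<dots> = (\<Sum>p\<in>D. emeasure lborel ((\<lambda>(u, v). {W u<..<W v}) p))"
    using sub W by (intro sum.cong) (force simp: split_def)+
  also have "\<dots> = emeasure lborel (\<Union>p\<in>D. (\<lambda>(u, v). {W u<..<W v}) p)"
    by (rule sum_emeasure[OF _ disjW fin]) auto
  also have "\<dots> \<le> emeasure lborel {W a..W b}"
  proof (rule emeasure_mono)
    show "(\<Union>p\<in>D. (\<lambda>(u, v). {W u<..<W v}) p) \<subseteq> {W a..W b}"
    proof clarsimp
      fix u v z assume "(u, v) \<in> D" "W u < z" "z < W v"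
      then show "W a \<le> z \<and> z \<le> W b"
        using sub[of u v] W[of a u] W[of v b] by auto
    qed
  qed auto
  also have "\<dots> = ennreal (W b - W a)" using W \<open>a \<le> b\<close> by simp
  finally show ?thesis using W[of a b] \<open>a \<le> b\<close> by (subst (asm) ennreal_le_iff) auto
qed

text \<open>
  Optimizing over \<open>\<mu>\<close> turns the hypothesis into
  \<open>norm (\<gamma> v - \<gamma> u)\<^sup>2 \<le> 4 * (v - u) * (W v - W u)\<close>, the estimate that the Cauchy-Schwarz inequality
  gives for a curve of finite energy when \<open>W\<close> is a multiple of the energy spent so far.  It yields
  absolute continuity without exhibiting the curve as an indefinite integral.  The form with \<open>\<mu>\<close> is
  linear in the increments, so it can be summed over intervals with a common \<open>\<mu>\<close>.
\<close>

lemma abs_continuous_on_energy: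
  fixes \<gamma> :: "real \<Rightarrow> 'a::real_normed_vector" and W :: "real \<Rightarrow> real"
  assumes mono: "mono_on {a..b} W" and "a \<le> b"
    and bnd: "\<And>u v \<mu>. a \<le> u \<Longrightarrow> u < v \<Longrightarrow> v \<le> b \<Longrightarrow> 0 < \<mu> \<Longrightarrow>
                norm (\<gamma> v - \<gamma> u) \<le> \<mu> * (v - u) + (W v - W u) / \<mu>"
  shows "abs_continuous_on a b \<gamma>"
  unfolding abs_continuous_on_def
proof (intro allI impI)
  fix \<epsilon> :: real assume "\<epsilon> > 0"
  define M where "M = W b - W a"
  have "M \<ge> 0" using mono_onD[OF mono, of a b] \<open>a \<le> b\<close> by (auto simp: M_def)
  \<comment> \<open>Large enough that the part of the bound governed by W stays below half of the tolerance;
    then small total length takes care of the other half.\<close>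
  define \<mu> where "\<mu> = 2 * (M + 1) / \<epsilon>"
  have "\<mu> > 0" using \<open>\<epsilon> > 0\<close> \<open>M \<ge> 0\<close> by (simp add: \<mu>_def)
  have M: "M / \<mu> \<le> \<epsilon> / 2" using \<open>\<epsilon> > 0\<close> \<open>M \<ge> 0\<close> by (simp add: \<mu>_def field_simps)
  show "\<exists>\<delta>>0. \<forall>D. finite D \<longrightarrow>
        (\<forall>(u, v)\<in>D. a \<le> u \<and> u < v \<and> v \<le> b) \<longrightarrow>
        disjoint_family_on (\<lambda>(u, v). {u<..<v}) D \<longrightarrow>
        (\<Sum>(u, v)\<in>D. v - u) < \<delta> \<longrightarrow> (\<Sum>(u, v)\<in>D. norm (\<gamma> v - \<gamma> u)) < \<epsilon>"
  proof (intro exI[of _ "\<epsilon> / (2 * \<mu>)"] conjI allI impI)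
    show "0 < \<epsilon> / (2 * \<mu>)" using \<open>\<epsilon> > 0\<close> \<open>\<mu> > 0\<close> by simp
    fix D :: "(real \<times> real) set"
    assume fin: "finite D" and sub: "\<forall>(u, v)\<in>D. a \<le> u \<and> u < v \<and> v \<le> b"
      and disj: "disjoint_family_on (\<lambda>(u, v). {u<..<v}) D"
      and small: "(\<Sum>(u, v)\<in>D. v - u) < \<epsilon> / (2 * \<mu>)"
    have "(\<Sum>(u, v)\<in>D. norm (\<gamma> v - \<gamma> u))
        \<le> (\<Sum>(u, v)\<in>D. \<mu> * (v - u) + (W v - W u) / \<mu>)"
      using sub \<open>\<mu> > 0\<close> by (intro sum_mono) (auto intro!: bnd)
    also have "\<dots> = \<mu> * (\<Sum>(u, v)\<in>D. v - u) + (\<Sum>(u, v)\<in>D. W v - W u) / \<mu>"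
      by (simp add: split_def sum.distrib sum_distrib_left sum_divide_distrib)
    also have "\<dots> \<le> \<mu> * (\<Sum>(u, v)\<in>D. v - u) + M / \<mu>"
      using sum_increments_le[OF mono \<open>a \<le> b\<close> fin _ disj] sub \<open>\<mu> > 0\<close>
      by (auto simp: M_def intro!: divide_right_mono)
    also have "\<dots> < \<mu> * (\<epsilon> / (2 * \<mu>)) + \<epsilon> / 2"
      using small M \<open>\<mu> > 0\<close> by (intro add_less_le_mono mult_strict_left_mono) auto
    also have "\<dots> = \<epsilon>" using \<open>\<mu> > 0\<close> by simp
    finally show "(\<Sum>(u, v)\<in>D. norm (\<gamma> v - \<gamma> u)) < \<epsilon>" .
  qed
qed

section \<open>Primitives of inverse square roots\<close>

text \<open>
  The exceptional set is needed for functions such as \<open>inv_sqrt_primitive\<close>, whose derivative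
  blows up at the collision times.
\<close>

lemma increasing_of_deriv_nonneg_off_finite:
  fixes F :: "real \<Rightarrow> real"
  assumes "finite P" "u \<le> v" "continuous_on {u..v} F"
    and der: "\<And>s. s \<in> {u..v} - P \<Longrightarrow> (F has_real_derivative f s) (at s)"
    and nonneg: "\<And>s. s \<in> {u..v} - P \<Longrightarrow> 0 \<le> f s"
  shows "F u \<le> F v"
proof -
  have "(f has_integral (F v - F u)) {u..v}"
    using assms by (intro fundamental_theorem_of_calculus_strong[of P])
      (auto simp: has_real_derivative_iff_has_vector_derivative[symmetric])
  then have "((\<lambda>s. if s \<in> P then 0 else f s) has_integral (F v - F u)) {u..v}"
    by (rule has_integral_spike_finite[OF \<open>finite P\<close>, rotated]) auto
  then have "0 \<le> F v - F u" by (rule has_integral_nonneg) (use nonneg in auto)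
  then show ?thesis by simp
qed

text \<open>
  The continuous primitive of \<open>\<lambda>s. 1 / sqrt \<bar>s - p\<bar>\<close>.  A two-body distance that vanishes linearly at
  time \<open>p\<close> contributes a multiple of this integrand to the Jacobi length.
\<close>

definition inv_sqrt_primitive :: "real \<Rightarrow> real \<Rightarrow> real" where
  "inv_sqrt_primitive p s = 2 * sgn (s - p) * sqrt \<bar>s - p\<bar>"

lemma inv_sqrt_primitive_eq:
  "inv_sqrt_primitive p s = (if p \<le> s then 2 * sqrt (s - p) else - 2 * sqrt (p - s))"
  by (auto simp: inv_sqrt_primitive_def sgn_if)

lemma continuous_on_inv_sqrt_primitive: "continuous_on A (inv_sqrt_primitive p)"
proof -
  have "continuous_on ({..p} \<union> {p..}) (inv_sqrt_primitive p)"
  proof (rule continuous_on_closed_Un)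
    show "continuous_on {..p} (inv_sqrt_primitive p)"
      by (rule continuous_on_eq[where f = "\<lambda>s. - 2 * sqrt (p - s)"])
        (auto simp: inv_sqrt_primitive_eq intro!: continuous_intros)
    show "continuous_on {p..} (inv_sqrt_primitive p)"
      by (rule continuous_on_eq[where f = "\<lambda>s. 2 * sqrt (s - p)"])
        (auto simp: inv_sqrt_primitive_eq intro!: continuous_intros)
  qed auto
  then show ?thesis by (rule continuous_on_subset) auto
qed

lemma inv_sqrt_primitive_deriv:
  assumes "s \<noteq> p"
  shows "(inv_sqrt_primitive p has_real_derivative 1 / sqrt \<bar>s - p\<bar>) (at s)"
proof (cases "p < s")
  case True
  have "((\<lambda>s. 2 * sqrt (s - p)) has_real_derivative 1 / sqrt \<bar>s - p\<bar>) (at s)"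
    using True by (auto intro!: derivative_eq_intros simp: field_simps)
  then show ?thesis
    by (rule has_field_derivative_transform_within_open[where S = "{p<..}"])
      (use True in \<open>auto simp: inv_sqrt_primitive_eq\<close>)
next
  case False
  then have "s < p" using assms by simp
  have "((\<lambda>s. - 2 * sqrt (p - s)) has_real_derivative 1 / sqrt \<bar>s - p\<bar>) (at s)"
    using \<open>s < p\<close> by (auto intro!: derivative_eq_intros simp: field_simps)
  then show ?thesis
    by (rule has_field_derivative_transform_within_open[where S = "{..<p}"])
      (use \<open>s < p\<close> in \<open>auto simp: inv_sqrt_primitive_eq\<close>)
qed

text \<open>
  The bound is uniform in \<open>p\<close>, since nothing is known about the times of closest approach.
\<close>

lemma inv_sqrt_primitive_increment:
  assumes "a \<le> b"
  shows "inv_sqrt_primitive p b - inv_sqrt_primitive p a \<le> 4 * sqrt (b - a)"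
proof -
  have sub: "sqrt y \<le> sqrt x + sqrt (y - x)" if "0 \<le> x" "x \<le> y" for x y :: real
    using sqrt_add_le_add_sqrt[of x "y - x"] that by simp
  consider "p \<le> a" | "a < p" "p \<le> b" | "b < p" by linarith
  then show ?thesis
  proof cases
    case 1
    have "inv_sqrt_primitive p b - inv_sqrt_primitive p a = 2 * (sqrt (b - p) - sqrt (a - p))"
      using 1 assms by (simp add: inv_sqrt_primitive_eq)
    also have "\<dots> \<le> 2 * sqrt (b - a)" using 1 assms sub[of "a - p" "b - p"] by simp
    also have "\<dots> \<le> 4 * sqrt (b - a)" using assms by simp
    finally show ?thesis .
  next
    case 2
    have "sqrt (b - p) \<le> sqrt (b - a)" "sqrt (p - a) \<le> sqrt (b - a)" using 2 by auto
    moreover have "inv_sqrt_primitive p b - inv_sqrt_primitive p a = 2 * sqrt (b - p) + 2 * sqrt (p - a)"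
      using 2 by (simp add: inv_sqrt_primitive_eq)
    ultimately show ?thesis by linarith
  next
    case 3
    have "inv_sqrt_primitive p b - inv_sqrt_primitive p a = 2 * (sqrt (p - a) - sqrt (p - b))"
      using 3 assms by (simp add: inv_sqrt_primitive_eq)
    also have "\<dots> \<le> 2 * sqrt (b - a)" using 3 assms sub[of "p - b" "p - a"] by simp
    also have "\<dots> \<le> 4 * sqrt (b - a)" using assms by simp
    finally show ?thesis .
  qed
qed

section \<open>The mass norm\<close>

lemma mass_norm_nonneg:
  assumes "\<And>i. 0 \<le> m i" shows "0 \<le> mass_norm m x"
  unfolding mass_norm_def mass_inner_def using assms by (auto intro!: sum_nonneg)

lemma mass_norm_scaleR: "mass_norm m (c *\<^sub>R x) = \<bar>c\<bar> * mass_norm m x"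
proof -
  have "mass_inner m (c *\<^sub>R x) (c *\<^sub>R x) = c\<^sup>2 * mass_inner m x x"
    by (simp add: mass_inner_def sum_distrib_left power2_eq_square mult_ac)
  then show ?thesis by (simp add: mass_norm_def real_sqrt_mult)
qed

text \<open>
  Together with the next lemma this passes between the norm in which the statement is phrased and
  the library norm, for which the triangle inequality is available.
\<close>

lemma mass_norm_le_norm:
  assumes "\<And>i. 0 \<le> m i"
  shows "mass_norm m v \<le> sqrt (\<Sum>i\<in>UNIV. m i) * norm v"
proof -
  have "mass_inner m v v \<le> (\<Sum>i\<in>UNIV. m i * (norm v)\<^sup>2)"
    unfolding mass_inner_def dot_square_norm
    using assms by (intro sum_mono mult_left_mono power_mono Finite_Cartesian_Product.norm_nth_le) auto
  then have "mass_norm m v \<le> sqrt ((\<Sum>i\<in>UNIV. m i) * (norm v)\<^sup>2)"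
    unfolding mass_norm_def by (simp add: sum_distrib_right)
  then show ?thesis by (simp add: real_sqrt_mult)
qed

lemma norm_le_mass_norm:
  assumes "\<And>i. \<mu> \<le> m i" "0 < \<mu>"
  shows "norm v \<le> mass_norm m v / sqrt \<mu>"
proof -
  have "\<mu> * (norm v)\<^sup>2 = (\<Sum>i\<in>UNIV. \<mu> * (norm (v $ i))\<^sup>2)"
    by (simp add: norm_vec_def L2_set_def sum_nonneg sum_distrib_left)
  also have "\<dots> \<le> mass_inner m v v"
    unfolding mass_inner_def dot_square_norm
    using assms by (intro sum_mono mult_right_mono) auto
  finally have "sqrt (\<mu> * (norm v)\<^sup>2) \<le> mass_norm m v" unfolding mass_norm_def by simp
  then show ?thesis using assms(2) by (simp add: real_sqrt_mult field_simps)
qed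

section \<open>Action and Jacobi length\<close>

text \<open>
  The curve parameter \<open>s\<close> is replaced by the time \<open>T\<close> with \<open>T' = V * \<tau>\<close>.  The difficulty is that
  \<open>\<tau>\<close> may vanish on \<open>P\<close>, so that the inverse \<open>S\<close> of \<open>T\<close> has infinite speed there.  Both the injectivity
  of \<open>T\<close> and the control of \<open>S\<close> come from one inequality: by the inequality of arithmetic and geometric
  means, \<open>2 \<le> \<mu> * V * \<tau> + 1 / (\<mu> * V * \<tau>)\<close>, and integrating this gives the last conclusion, which is,
  up to constants, the hypothesis of \<open>abs_continuous_on_energy\<close>.
\<close>

lemma exists_time_change:
  fixes \<tau> W w :: "real \<Rightarrow> real"
  assumes "0 < L" "0 < V" "finite P"
    and cont: "continuous_on UNIV \<tau>" and \<tau>_nonneg: "\<And>s. 0 \<le> \<tau> s"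
    and \<tau>_pos: "\<And>s. s \<notin> P \<Longrightarrow> 0 < \<tau> s"
    and W_cont: "continuous_on {0..L} W"
    and W_der: "\<And>s. s \<notin> P \<Longrightarrow> (W has_real_derivative w s) (at s)"
    and w_ge: "\<And>s. s \<notin> P \<Longrightarrow> 1 / \<tau> s \<le> w s"
  obtains T S :: "real \<Rightarrow> real" where
    "T 0 = 0" "0 < T L"
    "\<And>s. s \<in> {0..L} \<Longrightarrow> (T has_real_derivative V * \<tau> s) (at s)"
    "\<And>s. s \<in> {0..L} \<Longrightarrow> T s \<in> {0..T L} \<and> S (T s) = s"
    "\<And>t. t \<in> {0..T L} \<Longrightarrow> S t \<in> {0..L} \<and> T (S t) = t"
    "continuous_on {0..T L} S"
    "mono_on {0..T L} S" "mono_on {0..T L} (\<lambda>t. W (S t))"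
    "\<And>u v \<mu>. 0 \<le> u \<Longrightarrow> u \<le> v \<Longrightarrow> v \<le> T L \<Longrightarrow> 0 < \<mu> \<Longrightarrow>
       2 * (S v - S u) \<le> \<mu> * (v - u) + (W (S v) - W (S u)) / (V * \<mu>)"
proof -
  \<comment> \<open>Starting the integral at -1 makes T differentiable in the two-sided sense at 0 as well.\<close>
  define T where "T s = integral {-1..s} (\<lambda>r. V * \<tau> r) - integral {-1..0} (\<lambda>r. V * \<tau> r)" for s
  define S where "S = inv_into {0..L} T"
  have T_der: "(T has_real_derivative V * \<tau> s) (at s)" if "s \<in> {0..L}" for s
  proof -
    have "((\<lambda>x. integral {-1..x} (\<lambda>r. V * \<tau> r)) has_real_derivative V * \<tau> s)
            (at s within {-1..L + 1})"
      using that continuous_on_subset[OF cont]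
      by (intro integral_has_real_derivative continuous_intros) auto
    then have "((\<lambda>x. integral {-1..x} (\<lambda>r. V * \<tau> r)) has_real_derivative V * \<tau> s) (at s)"
      using that by (subst (asm) at_within_interior) auto
    from DERIV_diff[OF this DERIV_const] show ?thesis by (simp add: T_def[abs_def])
  qed
  have T_cont: "continuous_on {0..L} T"
    by (rule DERIV_continuous_on) (blast intro: T_der has_field_derivative_at_within)
  have energy: "2 * (v - u) \<le> \<mu> * (T v - T u) + (W v - W u) / (V * \<mu>)"
    if "0 \<le> u" "u \<le> v" "v \<le> L" "0 < \<mu>" for u v \<mu>
  proof -
    have "\<mu> * T u + W u / (V * \<mu>) - 2 * u \<le> \<mu> * T v + W v / (V * \<mu>) - 2 * v"
    proof (rule increasing_of_deriv_nonneg_off_finite[OF \<open>finite P\<close> \<open>u \<le> v\<close>])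
      show "continuous_on {u..v} (\<lambda>s. \<mu> * T s + W s / (V * \<mu>) - 2 * s)"
        using that \<open>0 < V\<close> by (intro continuous_intros continuous_on_subset[OF T_cont]
            continuous_on_subset[OF W_cont]) auto
      fix s assume s: "s \<in> {u..v} - P"
      show "((\<lambda>s. \<mu> * T s + W s / (V * \<mu>) - 2 * s) has_real_derivative
              \<mu> * (V * \<tau> s) + w s / (V * \<mu>) - 2) (at s)"
        using s that \<open>0 < V\<close> by (auto intro!: derivative_eq_intros T_der W_der)
      \<comment> \<open>The derivative is at least z + 1/z - 2 for the following z, and this is a square over z.\<close>
      define z where "z = V * \<mu> * \<tau> s"
      have "0 < V * \<mu>" "0 < z" using s that \<open>0 < V\<close> \<tau>_pos[of s] by (auto simp: z_def)
      have "0 \<le> (z - 1)\<^sup>2 / z" using \<open>0 < z\<close> by simp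
      also have "\<dots> = z + 1 / z - 2" using \<open>0 < z\<close> by (simp add: power2_eq_square field_simps)
      also have "1 / z = (1 / \<tau> s) / (V * \<mu>)" by (simp add: z_def)
      also have "\<dots> \<le> w s / (V * \<mu>)"
        using w_ge[of s] s \<open>0 < V * \<mu>\<close> by (intro divide_right_mono) auto
      finally show "0 \<le> \<mu> * (V * \<tau> s) + w s / (V * \<mu>) - 2" by (simp add: z_def mult_ac)
    qed
    then show ?thesis by (simp add: algebra_simps diff_divide_distrib)
  qed
  have W_mono: "W u \<le> W v" if "0 \<le> u" "u \<le> v" "v \<le> L" for u v
  proof (rule increasing_of_deriv_nonneg_off_finite[OF \<open>finite P\<close> \<open>u \<le> v\<close>, of W w])
    show "0 \<le> w s" if "s \<in> {u..v} - P" for s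
      using w_ge[of s] \<tau>_pos[of s] that by (smt (verit) DiffD2 divide_nonneg_pos)
  qed (use that W_der continuous_on_subset[OF W_cont] in auto)
  \<comment> \<open>If T did not increase on [u, v], the energy inequality would give
    2 * (v - u) <= (W v - W u) / (V * mu) for every mu, which a large mu refutes.\<close>
  have T_less: "T u < T v" if "0 \<le> u" "u < v" "v \<le> L" for u v
  proof (rule ccontr)
    assume "\<not> T u < T v"
    define M where "M = W v - W u"
    have "0 \<le> M" using W_mono[of u v] that by (simp add: M_def)
    define \<mu> where "\<mu> = (M + 1) / (V * (v - u))"
    have "0 < \<mu>" using \<open>0 \<le> M\<close> \<open>0 < V\<close> that by (simp add: \<mu>_def)
    then have "2 * (v - u) \<le> M / (V * \<mu>)"
      using energy[of u v \<mu>] that \<open>\<not> T u < T v\<close> mult_nonneg_nonpos[of \<mu> "T v - T u"]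
      by (simp add: M_def)
    also have "M / (V * \<mu>) = (v - u) * (M / (M + 1))"
      using \<open>0 < V\<close> that by (simp add: \<mu>_def)
    also have "\<dots> \<le> (v - u) * 1" using \<open>0 \<le> M\<close> that by (intro mult_left_mono) auto
    finally show False using that by simp
  qed
  have T_le: "T u \<le> T v" if "0 \<le> u" "u \<le> v" "v \<le> L" for u v
    using T_less[of u v] that by (cases "u = v") auto
  have inj: "inj_on T {0..L}"
    by (rule linorder_inj_onI) (use T_less in \<open>force+\<close>)
  have T0: "T 0 = 0" by (simp add: T_def)
  have T_in: "T s \<in> {0..T L}" if "s \<in> {0..L}" for s
    using T_le[of 0 s] T_le[of s L] that T0 by auto
  have ST: "S (T s) = s" if "s \<in> {0..L}" for s
    unfolding S_def by (rule inv_into_f_f[OF inj that])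
  have image: "T ` {0..L} = {0..T L}"
  proof
    show "{0..T L} \<subseteq> T ` {0..L}"
    proof
      fix t assume "t \<in> {0..T L}"
      then obtain s where "0 \<le> s" "s \<le> L" "T s = t"
        using IVT'[of T 0 t L] T_cont T0 \<open>0 < L\<close> by auto
      then show "t \<in> T ` {0..L}" by auto
    qed
  qed (use T_in in auto)
  have S_in: "S t \<in> {0..L}" and TS: "T (S t) = t" if "t \<in> {0..T L}" for t
    using that image inv_into_into[of t T "{0..L}"] f_inv_into_f[of t T "{0..L}"]
    by (auto simp: S_def)
  have S_cont: "continuous_on {0..T L} S"
    using continuous_on_inv[OF T_cont compact_Icc, of S] ST image by auto
  have S_mono: "S u \<le> S v" if "u \<in> {0..T L}" "v \<in> {0..T L}" "u \<le> v" for u v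
  proof (rule ccontr)
    assume "\<not> S u \<le> S v"
    then have "T (S v) < T (S u)" using T_less[of "S v" "S u"] S_in that by auto
    then show False using TS that by auto
  qed
  show ?thesis
  proof (rule that[of T S])
    show "0 < T L" using T_less[of 0 L] T0 \<open>0 < L\<close> by simp
    show "mono_on {0..T L} S" using S_mono by (auto intro!: mono_onI)
    show "mono_on {0..T L} (\<lambda>t. W (S t))"
      using S_mono S_in by (intro mono_onI W_mono) auto
    fix u v \<mu> :: real assume "0 \<le> u" "u \<le> v" "v \<le> T L" "0 < \<mu>"
    then show "2 * (S v - S u) \<le> \<mu> * (v - u) + (W (S v) - W (S u)) / (V * \<mu>)"
      using energy[of "S u" "S v" \<mu>] S_mono[of u v] S_in[of u] S_in[of v] TS[of u] TS[of v] by auto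
  qed (use T0 T_der T_in ST S_in TS S_cont in auto)
qed

text \<open>
  The Maupertuis principle in the form of an upper bound.  If \<open>1 / \<tau>\<close> dominates \<open>sqrt (U + h)\<close> along
  a path \<open>c\<close> of speed at most \<open>V\<close>, run the path with the time change \<open>T' = V * \<tau>\<close>.  Its speed becomes
  at most \<open>1 / \<tau>\<close>, its Lagrangian at most \<open>3 / (2 * \<tau>\<^sup>2)\<close>, and substituting \<open>t = T s\<close> turns the action
  into at most the integral of \<open>3 * V / (2 * \<tau>)\<close>, up to a constant the length of \<open>c\<close> in the Jacobi metric.
  The gain is that collisions enter through the square root of the potential only, which is
  integrable along straight lines.
\<close>

lemma action_potential_le_jacobi_length:
  fixes \<tau> W w :: "real \<Rightarrow> real"
    and m :: "'n::{finite,linorder} \<Rightarrow> real"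
    and c c' :: "real \<Rightarrow> ('e::euclidean_space, 'n) vec"
  assumes m_nonneg: "\<And>i. 0 \<le> m i"
    and "0 < L" "0 < V" "finite P"
    and cont: "continuous_on UNIV \<tau>" and \<tau>_nonneg: "\<And>s. 0 \<le> \<tau> s"
    and \<tau>_pos: "\<And>s. s \<notin> P \<Longrightarrow> 0 < \<tau> s"
    and W_cont: "continuous_on {0..L} W"
    and W_der: "\<And>s. s \<notin> P \<Longrightarrow> (W has_real_derivative w s) (at s)"
    and w_ge: "\<And>s. s \<notin> P \<Longrightarrow> 1 / \<tau> s \<le> w s"
    and "0 < K"
    and lip: "\<And>u v. 0 \<le> u \<Longrightarrow> u \<le> v \<Longrightarrow> v \<le> L \<Longrightarrow> norm (c v - c u) \<le> K * (v - u)"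
    and c_der: "\<And>s. s \<in> {0..L} - P \<Longrightarrow> (c has_vector_derivative c' s) (at s)"
    and speed: "\<And>s. s \<in> {0..L} - P \<Longrightarrow> mass_norm m (c' s) \<le> V"
    and pot: "\<And>s. s \<in> {0..L} - P \<Longrightarrow>
               newton_potential m (c s) + ennreal h \<le> ennreal (1 / (\<tau> s)\<^sup>2)"
  shows "action_potential m h (c 0) (c L) \<le> ennreal (3/2 * V * (W L - W 0))"
proof -
  obtain T S where T0: "T 0 = 0" and TL: "0 < T L"
    and T_der: "\<And>s. s \<in> {0..L} \<Longrightarrow> (T has_real_derivative V * \<tau> s) (at s)"
    and ST: "\<And>s. s \<in> {0..L} \<Longrightarrow> T s \<in> {0..T L} \<and> S (T s) = s"
    and TS: "\<And>t. t \<in> {0..T L} \<Longrightarrow> S t \<in> {0..L} \<and> T (S t) = t"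
    and S_cont: "continuous_on {0..T L} S" and S_mono: "mono_on {0..T L} S"
    and WS_mono: "mono_on {0..T L} (\<lambda>t. W (S t))"
    and energy: "\<And>u v \<mu>. 0 \<le> u \<Longrightarrow> u \<le> v \<Longrightarrow> v \<le> T L \<Longrightarrow> 0 < \<mu> \<Longrightarrow>
       2 * (S v - S u) \<le> \<mu> * (v - u) + (W (S v) - W (S u)) / (V * \<mu>)"
    using exists_time_change[OF \<open>0 < L\<close> \<open>0 < V\<close> \<open>finite P\<close> cont \<tau>_nonneg \<tau>_pos W_cont W_der w_ge]
    by blast
  define \<gamma> where "\<gamma> = c \<circ> S"
  have ends: "\<gamma> 0 = c 0" "\<gamma> (T L) = c L"
    using ST[of 0] ST[of L] T0 \<open>0 < L\<close> by (auto simp: \<gamma>_def)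
  have ac: "abs_continuous_on 0 (T L) \<gamma>"
  proof (rule abs_continuous_on_energy)
    \<comment> \<open>The factor absorbs the Lipschitz constant K when the parameter of the energy inequality
      is chosen as 2 * mu / K.\<close>
    show "mono_on {0..T L} (\<lambda>t. K\<^sup>2 / (4 * V) * W (S t))"
      using \<open>0 < V\<close> by (intro mono_onI mult_left_mono mono_onD[OF WS_mono]) auto
    fix u v \<mu> :: real assume uv: "0 \<le> u" "u < v" "v \<le> T L" "0 < \<mu>"
    have "norm (\<gamma> v - \<gamma> u) \<le> K * (S v - S u)"
      using uv TS[of u] TS[of v] mono_onD[OF S_mono, of u v] by (auto simp: \<gamma>_def intro!: lip)
    also have "\<dots> = K / 2 * (2 * (S v - S u))" by simp
    also have "\<dots> \<le> K / 2 * (2 * \<mu> / K * (v - u) + (W (S v) - W (S u)) / (V * (2 * \<mu> / K)))"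
      using uv \<open>0 < K\<close> by (intro mult_left_mono energy) auto
    also have "\<dots> = \<mu> * (v - u) + (K\<^sup>2 / (4 * V) * W (S v) - K\<^sup>2 / (4 * V) * W (S u)) / \<mu>"
      using uv \<open>0 < K\<close> \<open>0 < V\<close> by (simp add: field_simps power2_eq_square)
    finally show "norm (\<gamma> v - \<gamma> u) \<le>
      \<mu> * (v - u) + (K\<^sup>2 / (4 * V) * W (S v) - K\<^sup>2 / (4 * V) * W (S u)) / \<mu>" .
  qed (use TL in simp)
  have "action_potential m h (c 0) (c L) \<le> lagrangian_action m h 0 (T L) \<gamma>"
    unfolding action_potential_def using TL ac ends by (intro Inf_lower) blast
  \<comment> \<open>Off the finitely many exceptional times the new curve has speed at most 1 / tau, so its
    kinetic energy is at most half of the bound 1 / tau^2 for the potential term.\<close>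
  also have "\<dots> \<le> (\<integral>\<^sup>+t. ennreal (3/2 / (\<tau> (S t))\<^sup>2) * indicator {T 0..T L} t \<partial>lebesgue)"
    unfolding lagrangian_action_def
  proof (rule nn_integral_mono_AE)
    have "AE t in lebesgue. t \<notin> {0, T L} \<union> T ` P"
      using \<open>finite P\<close> by (intro AE_completion AE_not_in finite_imp_null_set_lborel) auto
    then show "AE t in lebesgue.
      (ennreal (1/2 * (mass_norm m (vector_derivative \<gamma> (at t within {0..T L})))\<^sup>2)
         + newton_potential m (\<gamma> t) + ennreal h) * indicator {0..T L} t
      \<le> ennreal (3/2 / (\<tau> (S t))\<^sup>2) * indicator {T 0..T L} t"
    proof eventually_elim
      case (elim t)
      show ?case
      proof (cases "t \<in> {0..T L}")
        case True
        with elim have t: "0 < t" "t < T L" by auto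
        define s where "s = S t"
        have s: "s \<in> {0..L}" "T s = t" using TS[OF True] by (auto simp: s_def)
        then have "s \<notin> P" using elim by auto
        then have "0 < \<tau> s" by (rule \<tau>_pos)
        have "(S has_real_derivative inverse (V * \<tau> s)) (at t)"
        proof (rule DERIV_inverse_function[where f = T and a = 0 and b = "T L"])
          show "(T has_real_derivative V * \<tau> s) (at (S t))"
            using T_der[OF s(1)] by (simp add: s_def)
          show "isCont S t" using t by (intro continuous_on_interior[OF S_cont]) auto
        qed (use t TS \<open>0 < \<tau> s\<close> \<open>0 < V\<close> in auto)
        then have "(\<gamma> has_vector_derivative inverse (V * \<tau> s) *\<^sub>R c' s) (at t)"
          unfolding \<gamma>_def has_real_derivative_iff_has_vector_derivative
          using c_der[of s] s \<open>s \<notin> P\<close> by (intro vector_diff_chain_at) (auto simp: s_def)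
        then have "vector_derivative \<gamma> (at t within {0..T L}) = inverse (V * \<tau> s) *\<^sub>R c' s"
          using t by (intro vector_derivative_at_within_ivl) auto
        then have "mass_norm m (vector_derivative \<gamma> (at t within {0..T L}))
            = inverse (V * \<tau> s) * mass_norm m (c' s)"
          using \<open>0 < V\<close> \<open>0 < \<tau> s\<close> by (simp add: mass_norm_scaleR)
        also have "\<dots> \<le> inverse (V * \<tau> s) * V"
          using speed[of s] s \<open>s \<notin> P\<close> \<open>0 < V\<close> \<open>0 < \<tau> s\<close> by (intro mult_left_mono) auto
        also have "\<dots> = 1 / \<tau> s" using \<open>0 < V\<close> by (simp add: field_simps)
        finally have "(mass_norm m (vector_derivative \<gamma> (at t within {0..T L})))\<^sup>2 \<le> (1 / \<tau> s)\<^sup>2"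
          by (intro power_mono mass_norm_nonneg m_nonneg)
        then have "ennreal (1/2 * (mass_norm m (vector_derivative \<gamma> (at t within {0..T L})))\<^sup>2)
             + newton_potential m (\<gamma> t) + ennreal h \<le> ennreal (1/2 * (1 / (\<tau> s)\<^sup>2)) + ennreal (1 / (\<tau> s)\<^sup>2)"
          using pot[of s] s \<open>s \<notin> P\<close> unfolding add.assoc
          by (intro add_mono ennreal_leI) (auto simp: \<gamma>_def s_def power_divide)
        also have "\<dots> = ennreal (3/2 / (\<tau> s)\<^sup>2)"
          by (subst ennreal_plus[symmetric]) auto
        finally show ?thesis using T0 True by (simp add: s_def)
      qed simp
    qed
  qed
  also have "\<dots> = (\<integral>\<^sup>+t. ennreal (3/2 / (\<tau> (S t))\<^sup>2) * indicator {T 0..T L} t \<partial>lborel)"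
    by (rule nn_integral_completion)
  also have "\<dots> = (\<integral>\<^sup>+s. ennreal (3/2 / (\<tau> (S (T s)))\<^sup>2 * (V * \<tau> s)) * indicator {0..L} s \<partial>lborel)"
    unfolding nn_integral_set_ennreal
  proof (rule nn_integral_substitution)
    have "(\<lambda>t. indicator {T 0..T L} t *\<^sub>R (\<tau> (S t))) \<in> borel_measurable borel"
      unfolding T0
      by (intro borel_measurable_continuous_on_indicator
            continuous_on_compose2[OF cont S_cont]) auto
    then have "(\<lambda>t. 3/2 / (indicator {T 0..T L} t *\<^sub>R (\<tau> (S t)))\<^sup>2) \<in> borel_measurable borel"
      by measurable
    then show "set_borel_measurable borel {T 0..T L} (\<lambda>t. 3/2 / (\<tau> (S t))\<^sup>2)"
      unfolding set_borel_measurable_def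
      by (rule measurable_cong[THEN iffD1, rotated]) (auto simp: indicator_def)
    show "continuous_on {0..L} (\<lambda>s. V * \<tau> s)"
      by (intro continuous_intros continuous_on_subset[OF cont]) auto
  qed (use T_der \<tau>_nonneg \<open>0 < V\<close> \<open>0 < L\<close> in auto)
  also have "\<dots> \<le> (\<integral>\<^sup>+s. ennreal (if s \<in> P then 0 else 3/2 * V * w s) * indicator {0..L} s \<partial>lborel)"
  proof (rule nn_integral_mono_AE)
    have "AE s in lborel. s \<notin> P"
      using \<open>finite P\<close> by (intro AE_not_in finite_imp_null_set_lborel)
    then show "AE s in lborel.
        ennreal (3/2 / (\<tau> (S (T s)))\<^sup>2 * (V * \<tau> s)) * indicator {0..L} s
        \<le> ennreal (if s \<in> P then 0 else 3/2 * V * w s) * indicator {0..L} s"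
    proof eventually_elim
      case (elim s)
      show ?case
      proof (cases "s \<in> {0..L}")
        case True
        have "0 < \<tau> s" using elim by (rule \<tau>_pos)
        have "3/2 / (\<tau> s)\<^sup>2 * (V * \<tau> s) = 3/2 * V * (1 / \<tau> s)"
          using \<open>0 < \<tau> s\<close> by (simp add: field_simps power2_eq_square)
        also have "\<dots> \<le> 3/2 * V * w s" using w_ge[OF elim] \<open>0 < V\<close> by (intro mult_left_mono) auto
        finally have "ennreal (3/2 / (\<tau> s)\<^sup>2 * (V * \<tau> s)) \<le> ennreal (3/2 * V * w s)"
          by (rule ennreal_leI)
        then show ?thesis using True elim ST[OF True] by auto
      qed simp
    qed
  qed
  also have "\<dots> = ennreal (3/2 * V * (W L - W 0))"
  proof (rule nn_integral_has_integral_lebesgue')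
    show "0 \<le> (if s \<in> P then 0 else 3/2 * V * w s)" for s
    proof (cases "s \<in> P")
      case False
      then have "0 \<le> w s" using w_ge[of s] \<tau>_pos[of s] by (smt (verit) divide_nonneg_pos)
      then show ?thesis using \<open>0 < V\<close> by simp
    qed simp
    have "(w has_integral (W L - W 0)) {0..L}"
      using W_der W_cont \<open>0 < L\<close> \<open>finite P\<close>
      by (intro fundamental_theorem_of_calculus_strong[of P])
        (auto simp: has_real_derivative_iff_has_vector_derivative[symmetric])
    from has_integral_mult_right[OF this, of "3/2 * V"]
    show "((\<lambda>s. if s \<in> P then 0 else 3/2 * V * w s) has_integral (3/2 * V * (W L - W 0))) {0..L}"
      by (rule has_integral_spike_finite[OF \<open>finite P\<close>, rotated]) auto
  qed
  finally show ?thesis .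
qed

section \<open>Paths with two straight legs\<close>

text \<open>
  Here \<open>s0\<close> is the time of closest approach to the origin.  Applied to the relative position of
  two bodies in uniform motion, it bounds their distance below by that of a head-on collision.
\<close>

lemma line_distance_lower_bound:
  fixes u v :: "'a::real_inner"
  shows "\<exists>s0. \<forall>s. norm v * \<bar>s - s0\<bar> \<le> norm (u + s *\<^sub>R v)"
proof (cases "v = 0")
  case False
  define s0 where "s0 = - (u \<bullet> v) / (v \<bullet> v)"
  have "norm v * \<bar>s - s0\<bar> \<le> norm (u + s *\<^sub>R v)" for s
  proof -
    have "(u + s *\<^sub>R v) \<bullet> v = (s - s0) * (v \<bullet> v)"
      using False by (simp add: s0_def inner_add_left field_simps)
    then have "\<bar>s - s0\<bar> * (v \<bullet> v) \<le> norm (u + s *\<^sub>R v) * norm v"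
      using Cauchy_Schwarz_ineq2[of "u + s *\<^sub>R v" v] by (simp add: abs_mult)
    then have "(norm v * \<bar>s - s0\<bar>) * norm v \<le> norm (u + s *\<^sub>R v) * norm v"
      by (simp add: dot_square_norm power2_eq_square mult_ac)
    then show ?thesis using False by (simp add: mult.commute)
  qed
  then show ?thesis by blast
qed auto

lemma newton_potential_le:
  assumes m_nonneg: "\<And>i. 0 \<le> m i" and "0 < \<rho>"
    and sep: "\<And>i j. i \<noteq> j \<Longrightarrow> \<rho> \<le> norm (x $ i - x $ j)"
  shows "newton_potential m x \<le> ennreal ((\<Sum>(i, j)\<in>{(i, j). i < j}. m i * m j) / \<rho>)"
proof -
  have "newton_potential m x \<le> (\<Sum>(i, j)\<in>{(i, j). i < j}. ennreal (m i * m j / \<rho>))"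
    unfolding newton_potential_def
  proof (rule sum_mono, clarsimp)
    fix i j :: 'a assume "i < j"
    then have "\<rho> \<le> norm (x $ i - x $ j)" by (intro sep) auto
    moreover from this have "0 < norm (x $ i - x $ j)" using \<open>0 < \<rho>\<close> by linarith
    ultimately show "ennreal (m i * m j) / ennreal (norm (x $ i - x $ j)) \<le> ennreal (m i * m j / \<rho>)"
      using \<open>0 < \<rho>\<close> m_nonneg
      by (subst divide_ennreal) (auto intro!: ennreal_leI divide_left_mono mult_pos_pos)
  qed
  also have "\<dots> = ennreal (\<Sum>(i, j)\<in>{(i, j). i < j}. m i * m j / \<rho>)"
    using m_nonneg \<open>0 < \<rho>\<close> by (subst sum_ennreal[symmetric]) (auto simp: split_def)
  finally show ?thesis by (simp add: split_def sum_divide_distrib)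
qed

text \<open>
  Over the parameter interval from 0 to 2 this goes straight from \<open>x\<close> to \<open>x + p\<close> and then straight on
  to \<open>x + p + q\<close>.  It is defined at all parameters so that its derivative exists at both ends.
\<close>

definition two_leg_path :: "'a::real_vector \<Rightarrow> 'a \<Rightarrow> 'a \<Rightarrow> real \<Rightarrow> 'a" where
  "two_leg_path x p q s = x + min s 1 *\<^sub>R p + max (s - 1) 0 *\<^sub>R q"

lemma two_leg_path_lipschitz:
  fixes x p q :: "'a::real_normed_vector"
  assumes "u \<le> v"
  shows "norm (two_leg_path x p q v - two_leg_path x p q u) \<le> (norm p + norm q) * (v - u)"
proof -
  have "two_leg_path x p q v - two_leg_path x p q u
      = (min v 1 - min u 1) *\<^sub>R p + (max (v - 1) 0 - max (u - 1) 0) *\<^sub>R q"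
    by (simp add: two_leg_path_def algebra_simps)
  also have "norm \<dots> \<le> \<bar>min v 1 - min u 1\<bar> * norm p + \<bar>max (v - 1) 0 - max (u - 1) 0\<bar> * norm q"
    by (metis norm_triangle_ineq norm_scaleR)
  also have "\<dots> \<le> (v - u) * norm p + (v - u) * norm q"
    using assms by (intro add_mono mult_right_mono) (auto simp: min_def max_def)
  finally show ?thesis by (simp add: algebra_simps)
qed

lemma two_leg_path_deriv:
  assumes "s \<noteq> 1"
  shows "(two_leg_path x p q has_vector_derivative (if s < 1 then p else q)) (at s)"
proof (cases "s < 1")
  case True
  have "((\<lambda>s. x + s *\<^sub>R p) has_vector_derivative p) (at s)"
    by (auto intro!: derivative_eq_intros)
  then have "(two_leg_path x p q has_vector_derivative p) (at s)"
    by (rule has_vector_derivative_transform_within_open[where S = "{..<1}"])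
      (use True in \<open>auto simp: two_leg_path_def\<close>)
  then show ?thesis using True by simp
next
  case False
  have "((\<lambda>s. x + p + (s - 1) *\<^sub>R q) has_vector_derivative q) (at s)"
    by (auto intro!: derivative_eq_intros)
  then have "(two_leg_path x p q has_vector_derivative q) (at s)"
    by (rule has_vector_derivative_transform_within_open[where S = "{1<..}"])
      (use False assms in \<open>auto simp: two_leg_path_def\<close>)
  then show ?thesis using False by simp
qed

text \<open>
  On each leg every relative position moves uniformly with speed at least \<open>R\<close>, so all mutual
  distances are bounded below by \<open>R\<close> times the distance to a finite set \<open>P\<close> of times, and the size of \<open>P\<close>
  depends on the number of bodies only.  The corner of the path, at time 1, is included in \<open>P\<close>.
\<close>

lemma two_leg_path_separation:
  fixes x p q :: "('e::euclidean_space, 'n::finite) vec"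
  assumes "0 \<le> R"
    and p: "\<And>i j. i \<noteq> j \<Longrightarrow> R \<le> norm (p $ i - p $ j)"
    and q: "\<And>i j. i \<noteq> j \<Longrightarrow> R \<le> norm (q $ i - q $ j)"
  obtains P where "finite P" "1 \<in> P" "card P \<le> 2 * CARD('n)\<^sup>2 + 1"
    "\<And>s i j. i \<noteq> j \<Longrightarrow>
       R * infdist s P \<le> norm (two_leg_path x p q s $ i - two_leg_path x p q s $ j)"
proof -
  have "\<forall>i j. \<exists>a. \<forall>s. norm (p $ i - p $ j) * \<bar>s - a\<bar>
            \<le> norm ((x $ i - x $ j) + s *\<^sub>R (p $ i - p $ j))"
    using line_distance_lower_bound by blast
  then obtain a where a: "\<And>i j s. norm (p $ i - p $ j) * \<bar>s - a i j\<bar>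
            \<le> norm ((x $ i - x $ j) + s *\<^sub>R (p $ i - p $ j))"
    by metis
  have "\<forall>i j. \<exists>b. \<forall>s. norm (q $ i - q $ j) * \<bar>s - b\<bar>
            \<le> norm (((x + p) $ i - (x + p) $ j) + s *\<^sub>R (q $ i - q $ j))"
    using line_distance_lower_bound by blast
  then obtain b where b: "\<And>i j s. norm (q $ i - q $ j) * \<bar>s - b i j\<bar>
            \<le> norm (((x + p) $ i - (x + p) $ j) + s *\<^sub>R (q $ i - q $ j))"
    by metis
  \<comment> \<open>Each pair of bodies contributes one time of closest approach on each leg.\<close>
  define A where "A = range (\<lambda>(i, j). a i j)"
  define B where "B = range (\<lambda>(i, j). 1 + b i j)"
  have card: "card A \<le> CARD('n)\<^sup>2" "card B \<le> CARD('n)\<^sup>2"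
    unfolding A_def B_def
    by (auto intro!: order.trans[OF card_image_le] simp: power2_eq_square)
  show ?thesis
  proof (rule that[of "insert 1 (A \<union> B)"])
    show "card (insert 1 (A \<union> B)) \<le> 2 * CARD('n)\<^sup>2 + 1"
      using card_insert_le_m1[of "2 * CARD('n)\<^sup>2 + 1" "A \<union> B" 1] card card_Un_le[of A B] by simp
    fix s :: real and i j :: 'n assume "i \<noteq> j"
    show "R * infdist s (insert 1 (A \<union> B))
            \<le> norm (two_leg_path x p q s $ i - two_leg_path x p q s $ j)"
    proof (cases "s \<le> 1")
      case True
      have "a i j \<in> insert 1 (A \<union> B)" by (force simp: A_def)
      then have "infdist s (insert 1 (A \<union> B)) \<le> \<bar>s - a i j\<bar>"
        by (metis infdist_le dist_real_def)
      then have "R * infdist s (insert 1 (A \<union> B)) \<le> norm (p $ i - p $ j) * \<bar>s - a i j\<bar>"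
        using p[OF \<open>i \<noteq> j\<close>] \<open>0 \<le> R\<close> by (intro mult_mono) (auto simp: infdist_nonneg)
      also note a[of i j s]
      also have "(x $ i - x $ j) + s *\<^sub>R (p $ i - p $ j)
          = two_leg_path x p q s $ i - two_leg_path x p q s $ j"
        using True by (simp add: two_leg_path_def algebra_simps)
      finally show ?thesis .
    next
      case False
      have "1 + b i j \<in> insert 1 (A \<union> B)" by (force simp: B_def)
      then have "infdist s (insert 1 (A \<union> B)) \<le> \<bar>(s - 1) - b i j\<bar>"
        by (metis infdist_le dist_real_def diff_diff_eq)
      then have "R * infdist s (insert 1 (A \<union> B)) \<le> norm (q $ i - q $ j) * \<bar>(s - 1) - b i j\<bar>"
        using q[OF \<open>i \<noteq> j\<close>] \<open>0 \<le> R\<close> by (intro mult_mono) (auto simp: infdist_nonneg)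
      also note b[of i j "s - 1"]
      also have "((x + p) $ i - (x + p) $ j) + (s - 1) *\<^sub>R (q $ i - q $ j)
          = two_leg_path x p q s $ i - two_leg_path x p q s $ j"
        using False by (simp add: two_leg_path_def algebra_simps)
      finally show ?thesis .
    qed
  qed (auto simp: A_def B_def)
qed

text \<open>
  Along the path the potential is at most \<open>B / (R * d)\<close>, where \<open>d\<close> is the distance to the finite set \<open>P\<close>
  of the preceding lemma.  Hence \<open>sqrt (U + h) \<le> sqrt h + sqrt (B / R) / sqrt d\<close>, whose integral is
  bounded independently of the endpoints.
\<close>

lemma action_potential_le_two_legs:
  fixes m :: "'n::{finite,linorder} \<Rightarrow> real"
    and x p q :: "('e::euclidean_space, 'n) vec"
  assumes m_nonneg: "\<And>i. 0 \<le> m i" and "0 \<le> h" "0 < R" "0 < V"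
    and speed: "mass_norm m p \<le> V" "mass_norm m q \<le> V"
    and p: "\<And>i j. i \<noteq> j \<Longrightarrow> R \<le> norm (p $ i - p $ j)"
    and q: "\<And>i j. i \<noteq> j \<Longrightarrow> R \<le> norm (q $ i - q $ j)"
    and "0 < B" and B: "(\<Sum>(i, j)\<in>{(i, j). i < j}. m i * m j) \<le> B"
  shows "action_potential m h x (x + p + q)
      \<le> ennreal (3/2 * V * (2 * sqrt h + sqrt (B / R) * (4 * sqrt 2 * (2 * CARD('n)\<^sup>2 + 1))))"
proof -
  let ?c = "two_leg_path x p q"
  obtain P where P: "finite P" "1 \<in> P" "card P \<le> 2 * CARD('n)\<^sup>2 + 1"
    and sep: "\<And>s i j. i \<noteq> j \<Longrightarrow> R * infdist s P \<le> norm (?c s $ i - ?c s $ j)"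
    using two_leg_path_separation[of R p q x, OF _ p q] \<open>0 < R\<close> by auto
  define d where "d s = infdist s P" for s :: real
  define K where "K = sqrt (B / R)"
  have "0 < K" using \<open>0 < B\<close> \<open>0 < R\<close> by (simp add: K_def)
  \<comment> \<open>Away from P this is the reciprocal of sqrt h + K / sqrt (d s); the fraction is cleared so that
    the function stays continuous on P, where it vanishes.\<close>
  define \<tau> where "\<tau> s = sqrt (d s) / (sqrt h * sqrt (d s) + K)" for s
  \<comment> \<open>Replacing the distance to the nearest point of P by the sum over all points of P makes the
    majorant explicitly integrable.\<close>
  define w where "w s = sqrt h + K * (\<Sum>r\<in>P. 1 / sqrt \<bar>s - r\<bar>)" for s
  define W where "W s = sqrt h * s + K * (\<Sum>r\<in>P. inv_sqrt_primitive r s)" for s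
  have d_nonneg: "0 \<le> d s" for s by (simp add: d_def infdist_nonneg)
  have denom: "0 < sqrt h * sqrt (d s) + K" for s
    using \<open>0 < K\<close> \<open>0 \<le> h\<close> d_nonneg[of s] by (intro add_nonneg_pos) auto
  have "closed P" using P(1) by (rule finite_imp_closed)
  have d_pos: "0 < d s" if "s \<notin> P" for s
    unfolding d_def using that \<open>closed P\<close> P(2) by (intro infdist_pos_not_in_closed) auto
  have inv_\<tau>: "1 / \<tau> s = sqrt h + K / sqrt (d s)" if "s \<notin> P" for s
    using d_pos[OF that] by (simp add: \<tau>_def field_simps)
  have "action_potential m h (?c 0) (?c 2) \<le> ennreal (3/2 * V * (W 2 - W 0))"
  proof (rule action_potential_le_jacobi_length[where P = P and \<tau> = \<tau> and w = w
        and K = "norm p + norm q + 1" and c' = "\<lambda>s. if s < 1 then p else q"])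
    show "continuous_on UNIV \<tau>"
      unfolding \<tau>_def d_def using denom
      by (intro continuous_intros) (auto simp: d_def less_imp_neq[symmetric])
    show "0 \<le> \<tau> s" for s
      unfolding \<tau>_def using d_nonneg[of s] denom[of s] by simp
    show "0 < \<tau> s" if "s \<notin> P" for s
      unfolding \<tau>_def using d_pos[OF that] denom[of s] by simp
    show "continuous_on {0..2} W"
      unfolding W_def by (intro continuous_intros continuous_on_inv_sqrt_primitive)
    show "(W has_real_derivative w s) (at s)" if "s \<notin> P" for s
    proof -
      have "((\<lambda>s. \<Sum>r\<in>P. inv_sqrt_primitive r s) has_real_derivative
               (\<Sum>r\<in>P. 1 / sqrt \<bar>s - r\<bar>)) (at s)"
        by (intro DERIV_sum inv_sqrt_primitive_deriv) (use that in auto)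
      then show ?thesis
        unfolding W_def[abs_def] w_def
        by (intro DERIV_add DERIV_cmult) (auto intro!: derivative_eq_intros)
    qed
    show "1 / \<tau> s \<le> w s" if s: "s \<notin> P" for s
    proof -
      obtain r where r: "r \<in> P" "d s = \<bar>s - r\<bar>"
        using infdist_attains_inf[OF \<open>closed P\<close>, of s] P(2) unfolding d_def dist_real_def by blast
      have "1 / sqrt (d s) \<le> (\<Sum>r\<in>P. 1 / sqrt \<bar>s - r\<bar>)"
        unfolding r(2) by (rule member_le_sum[OF r(1)]) (use P(1) in auto)
      then have "K * (1 / sqrt (d s)) \<le> K * (\<Sum>r\<in>P. 1 / sqrt \<bar>s - r\<bar>)"
        using \<open>0 < K\<close> by (intro mult_left_mono) auto
      then show ?thesis unfolding inv_\<tau>[OF s] w_def by simp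
    qed
    show "0 < norm p + norm q + 1" by (simp add: add_nonneg_pos)
    show "norm (?c v - ?c u) \<le> (norm p + norm q + 1) * (v - u)" if "u \<le> v" for u v
      by (rule order.trans[OF two_leg_path_lipschitz[OF that]]) (use that in \<open>auto intro!: mult_right_mono\<close>)
    show "(?c has_vector_derivative (if s < 1 then p else q)) (at s)" if "s \<in> {0..2} - P" for s
      using that P(2) by (intro two_leg_path_deriv) auto
    show "newton_potential m (?c s) + ennreal h \<le> ennreal (1 / (\<tau> s)\<^sup>2)" if "s \<in> {0..2} - P" for s
    proof -
      have s: "s \<notin> P" using that by simp
      have "0 < R * d s" using d_pos[OF s] \<open>0 < R\<close> by simp
      then have "newton_potential m (?c s)
          \<le> ennreal ((\<Sum>(i, j)\<in>{(i, j). i < j}. m i * m j) / (R * d s))"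
        by (intro newton_potential_le m_nonneg) (auto simp: d_def sep)
      also have "\<dots> \<le> ennreal (B / (R * d s))"
        using B \<open>0 < R * d s\<close> by (intro ennreal_leI divide_right_mono) auto
      finally have "newton_potential m (?c s) + ennreal h \<le> ennreal (B / (R * d s)) + ennreal h"
        by (rule add_right_mono)
      also have "\<dots> = ennreal (B / (R * d s) + h)"
        using \<open>0 < B\<close> \<open>0 < R * d s\<close> \<open>0 \<le> h\<close> by (intro ennreal_plus[symmetric]) auto
      also have "\<dots> \<le> ennreal ((1 / \<tau> s)\<^sup>2)"
      proof (rule ennreal_leI)
        have "B / (R * d s) + h = (K / sqrt (d s))\<^sup>2 + (sqrt h)\<^sup>2"
          using \<open>0 < B\<close> \<open>0 < R\<close> d_pos[OF s] \<open>0 \<le> h\<close> by (simp add: K_def power_divide)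
        also have "\<dots> \<le> (sqrt h + K / sqrt (d s))\<^sup>2"
          using \<open>0 < K\<close> d_pos[OF s] \<open>0 \<le> h\<close> by (simp add: power2_sum)
        finally show "B / (R * d s) + h \<le> (1 / \<tau> s)\<^sup>2" by (simp add: inv_\<tau>[OF s])
      qed
      finally show ?thesis by (simp add: power_divide)
    qed
  qed (use assms P in auto)
  also have "3/2 * V * (W 2 - W 0)
      \<le> 3/2 * V * (2 * sqrt h + K * (4 * sqrt 2 * (2 * CARD('n)\<^sup>2 + 1)))"
  proof (rule mult_left_mono)
    have "W 2 - W 0 = 2 * sqrt h + K * (\<Sum>r\<in>P. inv_sqrt_primitive r 2 - inv_sqrt_primitive r 0)"
      by (simp add: W_def sum_subtractf algebra_simps)
    also have "(\<Sum>r\<in>P. inv_sqrt_primitive r 2 - inv_sqrt_primitive r 0) \<le> (\<Sum>r\<in>P. 4 * sqrt 2)"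
      using inv_sqrt_primitive_increment[of 0 2] by (intro sum_mono) simp
    also have "\<dots> = 4 * sqrt 2 * real (card P)" by simp
    also have "\<dots> \<le> 4 * sqrt 2 * real (2 * CARD('n)\<^sup>2 + 1)"
      using P(3) by (intro mult_left_mono) (simp_all only: of_nat_le_iff, simp)
    finally show "W 2 - W 0 \<le> 2 * sqrt h + K * (4 * sqrt 2 * (2 * CARD('n)\<^sup>2 + 1))"
      using \<open>0 < K\<close> by simp
  qed (use \<open>0 < V\<close> in simp)
  finally show ?thesis
    by (simp add: two_leg_path_def K_def ennreal_leI)
qed

section \<open>The bound on the action potential\<close>

text \<open>
  Placing the bodies at distinct integer points of one line works in every dimension; the
  collisions that this may cause on the way are harmless.
\<close>

lemma exists_separated_configuration:
  "\<exists>w :: ('e::euclidean_space, 'n::finite) vec. \<forall>i j. i \<noteq> j \<longrightarrow> 1 \<le> norm (w $ i - w $ j)"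
proof -
  obtain f :: "'n \<Rightarrow> nat" where f: "inj f"
    using finite_imp_inj_to_nat_seg[of "UNIV :: 'n set"] by auto
  obtain e :: 'e where e: "norm e = 1" using norm_Basis nonempty_Basis by blast
  define w :: "('e, 'n) vec" where "w = (\<chi> i. real (f i) *\<^sub>R e)"
  have "1 \<le> norm (w $ i - w $ j)" if "i \<noteq> j" for i j
  proof -
    have "f i \<noteq> f j" using f that by (auto dest: injD)
    then have "1 \<le> \<bar>real (f i) - real (f j)\<bar>" by linarith
    then show ?thesis by (simp add: w_def scaleR_diff_left[symmetric] e)
  qed
  then show ?thesis by blast
qed

text \<open>
  A direct segment from \<open>x\<close> to \<open>y\<close> may keep two bodies together for its whole duration.  The detour
  through \<open>x + p\<close>, with \<open>p\<close> a multiple of order \<open>R\<close> of a fixed separated configuration, gives every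
  pair of bodies a relative velocity of size at least \<open>R\<close> on both legs, while its length is still of
  order \<open>R\<close>.  Its action is then of order \<open>R * sqrt h + sqrt R\<close>.
\<close>

lemma action_potential_le_of_distance_le:
  fixes m :: "'n::{finite,linorder} \<Rightarrow> real"
  assumes m_pos: "\<And>i. 0 < m i"
  shows "\<exists>\<alpha>>0. \<exists>\<beta>>0. \<forall>(x :: ('e::euclidean_space, 'n) vec) (y :: ('e, 'n) vec) h R.
           0 \<le> h \<longrightarrow> 0 < R \<longrightarrow> mass_norm m (x - y) \<le> R \<longrightarrow>
           action_potential m h x y \<le> ennreal (sqrt (\<alpha> * R + h * \<beta> * R\<^sup>2))"
proof -
  have m_nonneg: "0 \<le> m i" for i using m_pos[of i] by simp
  define \<mu> where "\<mu> = Min (range m)"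
  have "0 < \<mu>" "\<mu> \<le> m i" for i using m_pos by (auto simp: \<mu>_def)
  define D where "D = 1 / sqrt \<mu>"
  have "0 < D" using \<open>0 < \<mu>\<close> by (simp add: D_def)
  have D: "norm v \<le> D * mass_norm m v" for v :: "('e, 'n) vec"
    using norm_le_mass_norm[of \<mu> m v] \<open>0 < \<mu>\<close> \<open>\<And>i. \<mu> \<le> m i\<close> by (simp add: D_def)
  define M where "M = sqrt (\<Sum>i\<in>UNIV. m i)"
  have "0 < M" using m_pos by (simp add: M_def sum_pos)
  obtain w :: "('e, 'n) vec" where w: "\<And>i j. i \<noteq> j \<Longrightarrow> 1 \<le> norm (w $ i - w $ j)"
    using exists_separated_configuration by blast
  \<comment> \<open>The summand 1 keeps B positive.\<close>
  define B where "B = 1 + (\<Sum>(i, j)\<in>{(i, j). i < j}. m i * m j)"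
  have "0 < B" using m_nonneg by (auto simp: B_def intro!: add_pos_nonneg sum_nonneg)
  \<comment> \<open>The first leg separates every pair by kappa * R; the second leg undoes this separation up to
    the change of at most 2 * D * R prescribed by the endpoints, and so still moves it by R.\<close>
  define \<kappa> where "\<kappa> = 2 * D + 1"
  define C where "C = M * (D + \<kappa> * norm w)"
  have "0 < C" using \<open>0 < M\<close> \<open>0 < D\<close> by (simp add: C_def \<kappa>_def add_pos_nonneg)
  define a where "a = 3 * C"
  define b where "b = 3/2 * C * sqrt B * (4 * sqrt 2 * (2 * CARD('n)\<^sup>2 + 1))"
  have "0 < a" "0 < b"
    using \<open>0 < C\<close> \<open>0 < B\<close> by (auto simp: a_def b_def intro!: mult_pos_pos add_nonneg_pos)
  have "action_potential m h x y \<le> ennreal (sqrt (2 * b\<^sup>2 * R + h * (2 * a\<^sup>2) * R\<^sup>2))"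
    if "0 \<le> h" "0 < R" and xy: "mass_norm m (x - y) \<le> R" for x y :: "('e, 'n) vec" and h R
  proof -
    have yx: "norm (y - x) \<le> D * R"
      using order.trans[OF D[of "x - y"] mult_left_mono[OF xy, of D]] \<open>0 < D\<close>
      by (simp add: norm_minus_commute)
    define p where "p = (\<kappa> * R) *\<^sub>R w"
    define q where "q = (y - x) - p"
    have p_sep: "\<kappa> * R \<le> norm (p $ i - p $ j)" if "i \<noteq> j" for i j
      using w[OF that] \<open>0 < D\<close> \<open>0 < R\<close>
      by (simp add: p_def \<kappa>_def scaleR_diff_right[symmetric] abs_mult)
    have q_sep: "R \<le> norm (q $ i - q $ j)" if "i \<noteq> j" for i j
    proof -
      have "norm (p $ i - p $ j) \<le> norm (q $ i - q $ j) + norm ((y - x) $ i - (y - x) $ j)"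
        using norm_triangle_ineq4[of "(y - x) $ i - (y - x) $ j" "q $ i - q $ j"]
        by (simp add: q_def algebra_simps)
      also have "norm ((y - x) $ i - (y - x) $ j) \<le> norm ((y - x) $ i) + norm ((y - x) $ j)"
        by (rule norm_triangle_ineq4)
      also have "\<dots> \<le> D * R + D * R"
        by (intro add_mono order.trans[OF Finite_Cartesian_Product.norm_nth_le yx])
      finally show ?thesis using p_sep[OF that] by (simp add: \<kappa>_def algebra_simps)
    qed
    have p_norm: "norm p = \<kappa> * R * norm w"
      using \<open>0 < D\<close> \<open>0 < R\<close> by (simp add: p_def \<kappa>_def)
    have q_norm: "norm q \<le> D * R + \<kappa> * R * norm w"
      using norm_triangle_ineq4[of "y - x" p] yx p_norm by (simp add: q_def)
    have mass: "mass_norm m v \<le> C * R" if "norm v \<le> D * R + \<kappa> * R * norm w" for v :: "('e, 'n) vec"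
      using mass_norm_le_norm[of m v, OF m_nonneg] mult_left_mono[OF that, of M] \<open>0 < M\<close>
      by (simp add: C_def M_def algebra_simps)
    have "action_potential m h x (x + p + q)
      \<le> ennreal (3/2 * (C * R) * (2 * sqrt h + sqrt (B / R) * (4 * sqrt 2 * (2 * CARD('n)\<^sup>2 + 1))))"
    proof (rule action_potential_le_two_legs)
      show "R \<le> norm (p $ i - p $ j)" if "i \<noteq> j" for i j
      proof -
        have "1 * R \<le> \<kappa> * R" using \<open>0 < D\<close> \<open>0 < R\<close> by (intro mult_right_mono) (auto simp: \<kappa>_def)
        then show ?thesis using p_sep[OF that] by simp
      qed
    qed (use \<open>0 \<le> h\<close> \<open>0 < R\<close> \<open>0 < C\<close> \<open>0 < D\<close> \<open>0 < B\<close> m_nonneg q_sep q_norm p_norm in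
          \<open>auto intro!: mass simp: B_def\<close>)
    also have "3/2 * (C * R) * (2 * sqrt h + sqrt (B / R) * (4 * sqrt 2 * (2 * CARD('n)\<^sup>2 + 1)))
        = a * (R * sqrt h) + b * sqrt R"
    proof -
      have "R * sqrt (B / R) = sqrt B * sqrt R"
        using \<open>0 < R\<close> by (simp add: real_sqrt_divide field_simps)
      then show ?thesis by (simp add: a_def b_def algebra_simps)
    qed
    also have "\<dots> \<le> sqrt (2 * b\<^sup>2 * R + h * (2 * a\<^sup>2) * R\<^sup>2)"
    proof (rule real_le_rsqrt)
      have "(a * (R * sqrt h) + b * sqrt R)\<^sup>2 \<le> 2 * (a * (R * sqrt h))\<^sup>2 + 2 * (b * sqrt R)\<^sup>2"
        using zero_le_power2[of "a * (R * sqrt h) - b * sqrt R"]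
        unfolding power2_sum power2_diff by linarith
      also have "\<dots> = 2 * b\<^sup>2 * R + h * (2 * a\<^sup>2) * R\<^sup>2"
        using \<open>0 \<le> h\<close> \<open>0 < R\<close> by (simp add: power_mult_distrib)
      finally show "(a * (R * sqrt h) + b * sqrt R)\<^sup>2 \<le> 2 * b\<^sup>2 * R + h * (2 * a\<^sup>2) * R\<^sup>2" .
    qed
    finally show ?thesis
      by (simp add: q_def ennreal_leI)
  qed
  moreover have "0 < 2 * b\<^sup>2" "0 < 2 * a\<^sup>2" using \<open>0 < a\<close> \<open>0 < b\<close> by auto
  ultimately show ?thesis by blast
qed

theorem theorem2p11:
  fixes m :: "'n::{finite,linorder} \<Rightarrow> real"
  assumes "CARD('n) \<ge> 2"
    and "\<And>i. m i > 0"
  shows "\<exists>\<alpha>>0. \<exists>\<beta>>0. \<forall>(x :: ('e::euclidean_space, 'n) vec) (y :: ('e, 'n) vec) (h :: real). h \<ge> 0 \<longrightarrow>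
           action_potential m h x y
             \<le> ennreal (sqrt (\<alpha> * mass_norm m (x - y) + h * \<beta> * (mass_norm m (x - y))\<^sup>2))"
proof -
  obtain \<alpha> \<beta> where "0 < \<alpha>" "0 < \<beta>" and bound:
    "\<And>(x :: ('e, 'n) vec) y h R. 0 \<le> h \<Longrightarrow> 0 < R \<Longrightarrow> mass_norm m (x - y) \<le> R \<Longrightarrow>
       action_potential m h x y \<le> ennreal (sqrt (\<alpha> * R + h * \<beta> * R\<^sup>2))"
    using action_potential_le_of_distance_le[of m, OF assms(2)] by meson
  have "action_potential m h x y
      \<le> ennreal (sqrt (\<alpha> * mass_norm m (x - y) + h * \<beta> * (mass_norm m (x - y))\<^sup>2))"
    if "0 \<le> h" for x y :: "('e, 'n) vec" and h
  proof (rule LIMSEQ_le_const)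
    \<comment> \<open>Radii strictly above the distance also cover x = y, where the bound is 0.\<close>
    define r where "r k = mass_norm m (x - y) + 1 / real (Suc k)" for k
    have "r \<longlonglongrightarrow> mass_norm m (x - y) + 0"
      unfolding r_def[abs_def] by (intro tendsto_add tendsto_const lim_1_over_n[THEN LIMSEQ_Suc])
    then have "r \<longlonglongrightarrow> mass_norm m (x - y)" by simp
    then show "(\<lambda>k. ennreal (sqrt (\<alpha> * r k + h * \<beta> * (r k)\<^sup>2)))
      \<longlonglongrightarrow> ennreal (sqrt (\<alpha> * mass_norm m (x - y) + h * \<beta> * (mass_norm m (x - y))\<^sup>2))"
      by (intro tendsto_ennrealI tendsto_intros)
    have "0 \<le> mass_norm m (x - y)"
      using assms(2) by (intro mass_norm_nonneg less_imp_le)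
    then have "action_potential m h x y \<le> ennreal (sqrt (\<alpha> * r k + h * \<beta> * (r k)\<^sup>2))" for k
      using \<open>0 \<le> h\<close> by (intro bound) (auto simp: r_def add_nonneg_pos)
    then show "\<exists>N. \<forall>k\<ge>N. action_potential m h x y \<le> ennreal (sqrt (\<alpha> * r k + h * \<beta> * (r k)\<^sup>2))"
      by blast
  qed
  then show ?thesis using \<open>0 < \<alpha>\<close> \<open>0 < \<beta>\<close> by blast
qed

end
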